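(* Let $t_n^{\#1}$ be the number of rows with the value true in the truth tables of all the bracketed implications with $n$ variables, case 1. Then, as $n\to\infty$, $$t_n^{\#1} \sim \left(\frac{1}{2}\right)\frac{2^{3n-2}}{\sqrt{\pi n^3}}.$$
   Context: A bracketed implication with $n$ distinct variables is a formula obtained from $p_1\to p_2\to\cdots\to p_n$ (variables in this fixed order) by fully inserting brackets; for $n\ge2$ it has the form $\psi\to\phi$ with $\psi$ a bracketing of $p_1\to\cdots\to p_i$ and $\phi$ a bracketing of $p_{i+1}\to\cdots\to p_n$ for some $1\le i\le n-1$. A row is a pair consisting of a bracketed formula and a valuation of $p_1,\dots,p_n$ in $\{0,1\}$ (0 = false, 1 = true). Case 1 means: for $n\ge 2$, $t_n^{\#1}$ counts the rows (over all bracketed implications in $n$ variables) for which $\psi$ and $\phi$ both have value 1 (so that $\psi\to\phi$ is true). $u_n\sim v_n$ means $u_n/v_n\to1$. *)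

theory Defs
  imports Complex_Main "HOL-Library.FuncSet" "HOL-Library.Landau_Symbols"
begin

datatype formula = Var nat | Imp formula formula

(* The variables as they occur from left to right, i.e. what remains of
   the formula after all brackets have been erased. *)
primrec variable_sequence :: "formula \<Rightarrow> nat list" where
  "variable_sequence (Var i) = [i]"
| "variable_sequence (Imp \<psi> \<phi>) = variable_sequence \<psi> @ variable_sequence \<phi>"

(* The formulas obtained from p_1 -> p_2 -> ... -> p_n by fully inserting brackets;
   Var i stands for p_i. *)
definition bracketed_implications :: "nat \<Rightarrow> formula set" where
  "bracketed_implications n = {A. variable_sequence A = [1..<Suc n]}"

(* Extensional functions (undefined off {1..n}), so that there are exactly 2 ^ n of them. *)
definition valuations :: "nat \<Rightarrow> (nat \<Rightarrow> bool) set" where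
  "valuations n = {1..n} \<rightarrow>\<^sub>E UNIV"

primrec truth_value :: "(nat \<Rightarrow> bool) \<Rightarrow> formula \<Rightarrow> bool" where
  "truth_value v (Var i) = v i"
| "truth_value v (Imp \<psi> \<phi>) = (truth_value v \<psi> \<longrightarrow> truth_value v \<phi>)"

definition rows :: "nat \<Rightarrow> (formula \<times> (nat \<Rightarrow> bool)) set" where
  "rows n = bracketed_implications n \<times> valuations n"

definition case1_rows :: "nat \<Rightarrow> (formula \<times> (nat \<Rightarrow> bool)) set" where
  "case1_rows n =
     {(A, v) \<in> rows n. \<exists>\<psi> \<phi>. A = Imp \<psi> \<phi> \<and> truth_value v \<psi> \<and> truth_value v \<phi>}"

(* The notion is only meant for n >= 2; for n < 2 the value is 0. *)
definition t_case1 :: "nat \<Rightarrow> nat" where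
  "t_case1 n = card (case1_rows n)"

end

theory Submission
  imports Defs "HOL-Analysis.Gamma_Function"
begin

text \<open>
  Substituting the valuation into the formula turns rows into binary trees with truth values at
  the leaves. Let G and T be the generating functions of all trees and of the true ones, with the
  variable x rescaled by 1/8. Then G = x/4 + G^2 and T = x/8 + T^2 + (G - T) G, and case 1 is
  counted by T^2. The coefficients w(n) of G = (1 - sqrt (1 - x)) / 2 are asymptotic to
  n powr (-3/2) / (4 sqrt pi), and their sum is 1/2 because G(1) = 1/4 + G(1)^2.

  No singularity analysis of T is needed: a convolution of two sequences of order w(n) is
  determined up to o(w(n)) by its two ends. For the error d = t - c w at the expected limit ratio
  c, the equation of T therefore gives a linear relation that shrinks the upper limit of
  |d(n)| / w(n) by the factor G(1) = 1/2, so t(n) / w(n) tends to c. The coefficients of T^2,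
  divided by w(n), then tend to 2 c T(1), and this equals 1/2 by the quadratic equation for T(1).
\<close>

section \<open>Convolutions of sequences of polynomial decay\<close>

definition convolve :: "(nat \<Rightarrow> real) \<Rightarrow> (nat \<Rightarrow> real) \<Rightarrow> nat \<Rightarrow> real" where
  "convolve a b n = (\<Sum>i\<le>n. a i * b (n - i))"

lemma sum_atMost_halves:
  fixes f :: "nat \<Rightarrow> 'a::comm_monoid_add"
  shows "(\<Sum>i\<le>n. f i) = (\<Sum>k<n div 2 + 1. f k) + (\<Sum>k<n - n div 2. f (n - k))"
proof -
  have "(\<Sum>i\<le>n. f i) = (\<Sum>i\<in>{..<n div 2 + 1} \<union> {n div 2 + 1..n}. f i)"
    by (intro sum.cong) auto
  also have "\<dots> = (\<Sum>k<n div 2 + 1. f k) + (\<Sum>i\<in>{n div 2 + 1..n}. f i)"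
    by (intro sum.union_disjoint) auto
  also have "(\<Sum>i\<in>{n div 2 + 1..n}. f i) = (\<Sum>k<n - n div 2. f (n - k))"
    by (intro sum.reindex_bij_witness[of _ "\<lambda>k. n - k" "\<lambda>i. n - i"]) auto
  finally show ?thesis .
qed

text \<open>Reindexing the upper half by \<open>n - k\<close> makes both sums run over
  \<open>2 * k \<le> n\<close>, so each pairs the head of one sequence with far terms of the
  other.\<close>

lemma convolve_halves:
  "convolve a b n =
     (\<Sum>k<n div 2 + 1. a k * b (n - k)) + (\<Sum>k<n - n div 2. b k * a (n - k))"
  unfolding convolve_def sum_atMost_halves
  by (intro arg_cong2[where f = "(+)"] refl sum.cong) (auto simp: mult.commute)

text \<open>Models a \<open>w n\<close> asymptotic to \<open>L * real n powr (-s)\<close>, summable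
  since \<open>s > 1\<close>. The value \<open>w 0 = 0\<close> agrees with
  \<open>0 powr x = 0\<close> and makes quotients by \<open>w 0\<close> vanish.\<close>

locale regular_weight =
  fixes w :: "nat \<Rightarrow> real" and s L :: real
  assumes weight_0: "w 0 = 0"
    and weight_pos: "n > 0 \<Longrightarrow> w n > 0"
    and exponent: "s > 1"
    and constant_pos: "L > 0"
    and weight_limit: "(\<lambda>n. w n * real n powr s) \<longlonglongrightarrow> L"
begin

section \<open>Elementary estimates for weights of power decay\<close>

lemma weight_nonneg: "w n \<ge> 0"
  using weight_0 weight_pos[of n] by (cases "n = 0") auto

text \<open>Both \<open>w n * real n powr s\<close> and its inverse converge, the latter because
  \<open>L > 0\<close>, so both are bounded.\<close>

lemma weight_bounds:
  obtains A B where "A > 0" "B > 0" "\<And>n. w n \<le> B * real n powr (-s)"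
    "\<And>n. A * real n powr (-s) \<le> w n"
proof -
  have "Bseq (\<lambda>n. w n * real n powr s)"
    using weight_limit by (intro convergent_imp_Bseq convergentI)
  then obtain B where B: "B > 0" "\<And>n. norm (w n * real n powr s) \<le> B"
    by (auto elim: BseqE)
  have "(\<lambda>n. inverse (w n * real n powr s)) \<longlonglongrightarrow> inverse L"
    using constant_pos by (intro tendsto_inverse weight_limit) auto
  hence "Bseq (\<lambda>n. inverse (w n * real n powr s))"
    by (intro convergent_imp_Bseq convergentI)
  then obtain C where C: "C > 0" "\<And>n. norm (inverse (w n * real n powr s)) \<le> C"
    by (auto elim: BseqE)
  have "w n \<le> B * real n powr (-s)" for n
    using B(2)[of n] weight_0 weight_pos[of n]
    by (cases "n = 0") (auto simp: powr_minus field_simps)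
  moreover have "inverse C * real n powr (-s) \<le> w n" for n
    using C(1) C(2)[of n] weight_0 weight_pos[of n]
    by (cases "n = 0") (auto simp: powr_minus field_simps)
  ultimately show ?thesis using that[of "inverse C" B] B(1) C(1) by simp
qed

lemma summable_weight: "summable w"
proof -
  obtain A B where B: "\<And>n. w n \<le> B * real n powr (-s)" by (rule weight_bounds) blast
  have "summable (\<lambda>n. B * real n powr (-s))"
    using exponent by (intro summable_mult) (simp add: summable_real_powr_iff)
  thus ?thesis
    by (rule summable_comparison_test'[where N = 0]) (use B in \<open>auto simp: weight_nonneg\<close>)
qed

text \<open>Here \<open>n - k\<close> is at least n/2, and halving the argument costs the power only
  a factor \<open>2 powr s\<close>. This supplies the domination in
  \<open>head_sum_tendsto\<close>.\<close>

lemma weight_doubling: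
  obtains C where "C > 0" "\<And>n k. 2 * k \<le> n \<Longrightarrow> w (n - k) \<le> C * w n"
proof -
  obtain A B where AB: "A > 0" "B > 0" "\<And>n. w n \<le> B * real n powr (-s)"
    "\<And>n. A * real n powr (-s) \<le> w n" by (rule weight_bounds) blast
  have "w (n - k) \<le> (B * 2 powr s / A) * w n" if "2 * k \<le> n" for n k
  proof (cases "n = 0")
    case False
    have "w (n - k) \<le> B * real (n - k) powr (-s)" by (rule AB)
    also have "\<dots> \<le> B * (real n / 2) powr (-s)"
      using that False exponent AB(2) by (intro mult_left_mono powr_mono2') auto
    also have "(real n / 2) powr (-s) = 2 powr s * real n powr (-s)"
      by (simp add: powr_divide powr_minus field_simps)
    also have "B * (2 powr s * real n powr (-s)) = (B * 2 powr s / A) * (A * real n powr (-s))"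
      using AB(1) by simp
    also have "\<dots> \<le> (B * 2 powr s / A) * w n"
      using AB by (intro mult_left_mono) auto
    finally show ?thesis .
  qed (simp add: weight_0)
  thus ?thesis using that[of "B * 2 powr s / A"] AB by simp
qed

lemma weight_shift: "(\<lambda>n. w (n - k) / w n) \<longlonglongrightarrow> 1"
proof (rule LIMSEQ_offset[of _ k])
  have 1: "(\<lambda>n. w (n + k) * real (n + k) powr s) \<longlonglongrightarrow> L"
    using weight_limit by (rule LIMSEQ_ignore_initial_segment)
  have "(\<lambda>n. 1 + real k / real n) \<longlonglongrightarrow> 1 + 0"
    by (intro tendsto_add tendsto_const lim_const_over_n)
  hence 2: "(\<lambda>n. (1 + real k / real n) powr s) \<longlonglongrightarrow> 1 powr s"
    by (intro tendsto_powr) auto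
  have "(\<lambda>n. (w n * real n powr s) / (w (n + k) * real (n + k) powr s)
          * (1 + real k / real n) powr s) \<longlonglongrightarrow> L / L * 1 powr s"
    using constant_pos by (intro tendsto_mult tendsto_divide weight_limit 1 2) auto
  moreover have "eventually (\<lambda>n. (w n * real n powr s) / (w (n + k) * real (n + k) powr s)
          * (1 + real k / real n) powr s = w (n + k - k) / w (n + k)) sequentially"
    using eventually_gt_at_top[of 0]
  proof eventually_elim
    case (elim n)
    have "(1 + real k / real n) powr s = (real (n + k) / real n) powr s"
      using elim by (simp add: field_simps)
    also have "\<dots> = real (n + k) powr s / real n powr s" by (simp add: powr_divide)
    finally show ?case using elim by (simp add: field_simps)
  qed
  ultimately show "(\<lambda>n. w (n + k - k) / w (n + k)) \<longlonglongrightarrow> 1"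
    using constant_pos by (simp add: tendsto_cong)
qed

text \<open>Tannery's theorem: for fixed \<open>k\<close> the term divided by \<open>w n\<close>
  tends to \<open>a k * \<beta>\<close> by \<open>weight_shift\<close>, and
  \<open>weight_doubling\<close> bounds it by a constant multiple of \<open>\<bar>a k\<bar>\<close>,
  since only \<open>2 * k \<le> n\<close> occurs.\<close>

lemma head_sum_tendsto:
  assumes a: "summable (\<lambda>n. \<bar>a n\<bar>)"
    and b: "(\<lambda>n. b n / w n) \<longlonglongrightarrow> \<beta>"
    and m: "filterlim m at_top at_top" "\<And>n k. k < m n \<Longrightarrow> 2 * k \<le> n"
  shows "(\<lambda>n. (\<Sum>k<m n. a k * b (n - k)) / w n) \<longlonglongrightarrow> suminf a * \<beta>"
proof -
  obtain C where C: "C > 0" "\<And>n k. 2 * k \<le> n \<Longrightarrow> w (n - k) \<le> C * w n"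
    by (rule weight_doubling) blast
  have "Bseq (\<lambda>n. b n / w n)" using b by (intro convergent_imp_Bseq convergentI)
  then obtain M where M: "M > 0" "\<And>n. norm (b n / w n) \<le> M" by (auto elim: BseqE)
  \<comment> \<open>Padding with zeros from \<open>m n\<close> on turns the finite sum into a series
    over all \<open>k\<close>.\<close>
  define f where "f k n = (if k < m n then a k * b (n - k) / w n else 0)" for k n
  have bound: "norm (f k n) \<le> \<bar>a k\<bar> * (M * C)" for k n
  proof (cases "k < m n \<and> n > 0")
    case True
    hence "2 * k \<le> n" using m(2) by blast
    hence pos: "w (n - k) > 0" "w n > 0" and le: "w (n - k) \<le> C * w n"
      using True weight_pos C(2) by auto
    have "\<bar>b (n - k)\<bar> \<le> M * w (n - k)" using M(2)[of "n - k"] pos by (simp add: field_simps)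
    also have "\<dots> \<le> M * (C * w n)" using M(1) le by (intro mult_left_mono) auto
    finally have "\<bar>b (n - k)\<bar> / w n \<le> M * C" using pos by (simp add: field_simps)
    hence "\<bar>a k\<bar> * (\<bar>b (n - k)\<bar> / w n) \<le> \<bar>a k\<bar> * (M * C)"
      by (rule mult_left_mono) auto
    thus ?thesis using True pos by (simp add: f_def abs_mult)
  next
    case False
    thus ?thesis using M(1) C(1) weight_0 by (auto simp: f_def)
  qed
  have lim: "(\<lambda>n. f k n) \<longlonglongrightarrow> a k * \<beta>" for k
  proof -
    have "filterlim (\<lambda>n. n - k) at_top sequentially" by (rule filterlim_minus_const_nat_at_top)
    hence "(\<lambda>n. b (n - k) / w (n - k)) \<longlonglongrightarrow> \<beta>" by (rule filterlim_compose[OF b])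
    hence "(\<lambda>n. a k * (b (n - k) / w (n - k) * (w (n - k) / w n))) \<longlonglongrightarrow> a k * (\<beta> * 1)"
      by (intro tendsto_mult tendsto_const weight_shift)
    moreover have "eventually (\<lambda>n. a k * (b (n - k) / w (n - k) * (w (n - k) / w n)) = f k n) sequentially"
    proof -
      have "eventually (\<lambda>n. k < m n) sequentially"
        using m(1)[unfolded filterlim_at_top, rule_format, of "Suc k"] by (simp add: Suc_le_eq)
      moreover have "eventually (\<lambda>n. k < n) sequentially" by (rule eventually_gt_at_top)
      ultimately show ?thesis
      proof eventually_elim
        case (elim n)
        thus ?case using weight_pos[of "n - k"] by (simp add: f_def)
      qed
    qed
    ultimately show ?thesis by (simp add: tendsto_cong)
  qed
  have "(\<lambda>n. suminf (\<lambda>k. f k n)) \<longlonglongrightarrow> (\<Sum>k. a k * \<beta>)"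
    using tannerys_theorem[of f "\<lambda>k. a k * \<beta>" sequentially "\<lambda>k. \<bar>a k\<bar> * (M * C)"]
      lim bound summable_mult2[OF a] by (auto simp: case_prod_unfold)
  moreover have "suminf (\<lambda>k. f k n) = (\<Sum>k<m n. a k * b (n - k)) / w n" for n
    by (subst suminf_finite[of "{..<m n}"]) (auto simp: f_def sum_divide_distrib)
  moreover have "(\<Sum>k. a k * \<beta>) = suminf a * \<beta>"
    using summable_rabs_cancel[OF a] by (simp add: suminf_mult2)
  ultimately show ?thesis by simp
qed

lemma filterlim_halves:
  "filterlim (\<lambda>n::nat. n div 2 + 1) at_top at_top" "filterlim (\<lambda>n::nat. n - n div 2) at_top at_top"
proof -
  have "eventually (\<lambda>n. Z \<le> n div 2 + 1) sequentially" "eventually (\<lambda>n. Z \<le> n - n div 2) sequentially"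
    for Z :: nat
    by (rule eventually_mono[OF eventually_ge_at_top[of "2 * Z"]], linarith)+
  thus "filterlim (\<lambda>n::nat. n div 2 + 1) at_top at_top" "filterlim (\<lambda>n::nat. n - n div 2) at_top at_top"
    by (auto simp: filterlim_at_top)
qed

text \<open>The majorant \<open>E * w\<close> has eventually constant ratio \<open>E\<close> to
  \<open>w\<close>, so \<open>head_sum_tendsto\<close> gives the limit of the majorising sums, which
  lies strictly below \<open>q\<close>.\<close>

lemma head_sum_bound:
  assumes a: "summable (\<lambda>n. \<bar>a n\<bar>)"
    and b: "eventually (\<lambda>n. \<bar>b n\<bar> \<le> E * w n) sequentially"
    and m: "filterlim m at_top at_top" "\<And>n k. k < m n \<Longrightarrow> 2 * k \<le> n"
    and less: "(\<Sum>n. \<bar>a n\<bar>) * E < q"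
  shows "eventually (\<lambda>n. \<bar>\<Sum>k<m n. a k * b (n - k)\<bar> \<le> q * w n) sequentially"
proof -
  obtain N where N: "\<And>n. n \<ge> N \<Longrightarrow> \<bar>b n\<bar> \<le> E * w n"
    using b by (auto simp: eventually_at_top_linorder)
  have E: "(\<lambda>n. (E * w n) / w n) \<longlonglongrightarrow> E"
  proof (rule tendsto_eventually)
    show "eventually (\<lambda>n. (E * w n) / w n = E) sequentially"
      using eventually_gt_at_top[of 0] by eventually_elim (use weight_pos in \<open>simp add: less_imp_neq[symmetric]\<close>)
  qed
  have "(\<lambda>n. (\<Sum>k<m n. \<bar>a k\<bar> * (E * w (n - k))) / w n) \<longlonglongrightarrow> (\<Sum>n. \<bar>a n\<bar>) * E"
    using a by (intro head_sum_tendsto E m) auto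
  hence "eventually (\<lambda>n. (\<Sum>k<m n. \<bar>a k\<bar> * (E * w (n - k))) / w n < q) sequentially"
    using less by (rule order_tendstoD)
  \<comment> \<open>Together with \<open>2 * k \<le> n\<close> this forces
    \<open>N \<le> n - k\<close>, so the bound on \<open>b\<close> applies to every term; the
    \<open>+ 1\<close> keeps \<open>n\<close> positive.\<close>
  thus ?thesis using eventually_ge_at_top[of "2 * N + 1"]
  proof eventually_elim
    case (elim n)
    have "\<bar>\<Sum>k<m n. a k * b (n - k)\<bar> \<le> (\<Sum>k<m n. \<bar>a k * b (n - k)\<bar>)" by (rule sum_abs)
    also have "\<dots> \<le> (\<Sum>k<m n. \<bar>a k\<bar> * (E * w (n - k)))"
    proof (rule sum_mono)
      fix k assume "k \<in> {..<m n}"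
      hence "2 * k \<le> n" using m(2) by auto
      hence "N \<le> n - k" using elim by linarith
      thus "\<bar>a k * b (n - k)\<bar> \<le> \<bar>a k\<bar> * (E * w (n - k))"
        unfolding abs_mult by (intro mult_left_mono N) auto
    qed
    also have "\<dots> \<le> q * w n" using elim weight_pos[of n] by (simp add: field_simps)
    finally show ?case .
  qed
qed

text \<open>Each end of the convolution sees one sequence through its full sum and the other through
  its limiting ratio to \<open>w\<close>.\<close>

lemma convolve_tendsto:
  assumes "summable (\<lambda>n. \<bar>a n\<bar>)" "summable (\<lambda>n. \<bar>b n\<bar>)"
    and "(\<lambda>n. a n / w n) \<longlonglongrightarrow> \<alpha>" "(\<lambda>n. b n / w n) \<longlonglongrightarrow> \<beta>"
  shows "(\<lambda>n. convolve a b n / w n) \<longlonglongrightarrow> suminf a * \<beta> + suminf b * \<alpha>"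
  unfolding convolve_halves add_divide_distrib
  by (intro tendsto_add head_sum_tendsto assms filterlim_halves) auto

end

text \<open>Iterating the improvement from \<open>E\<close> to a smaller multiple, starting from the
  \<open>Bseq\<close> bound, gives geometrically decreasing eventual bounds.\<close>

lemma tendsto_zero_if_contracting:
  fixes e :: "nat \<Rightarrow> real"
  assumes "Bseq e" and q: "0 \<le> q" "q < 1"
    and contract: "\<And>E. E > 0 \<Longrightarrow> eventually (\<lambda>n. \<bar>e n\<bar> \<le> E) sequentially \<Longrightarrow>
           eventually (\<lambda>n. \<bar>e n\<bar> \<le> q * E) sequentially"
  shows "e \<longlonglongrightarrow> 0"
proof -
  obtain M where M: "M > 0" "\<And>n. norm (e n) \<le> M" using assms(1) by (auto elim: BseqE)
  have contract': "eventually (\<lambda>n. \<bar>e n\<bar> \<le> q' * E) sequentially"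
    if "E > 0" "eventually (\<lambda>n. \<bar>e n\<bar> \<le> E) sequentially" "q \<le> q'" for E q'
    using contract[OF that(1,2)] by eventually_elim (use that in \<open>auto intro: order_trans mult_right_mono\<close>)
  \<comment> \<open>The midpoint of \<open>q\<close> and 1 is positive even for
    \<open>q = 0\<close>, so every \<open>p ^ j * M\<close> remains admissible as an
    \<open>E > 0\<close>.\<close>
  define p where "p = (1 + q) / 2"
  have p: "p > 0" "p < 1" "q \<le> p" using q by (auto simp: p_def)
  have iterate: "eventually (\<lambda>n. \<bar>e n\<bar> \<le> p ^ j * M) sequentially" for j
  proof (induction j)
    case 0
    show ?case using M by auto
  next
    case (Suc j)
    show ?case using contract'[OF _ Suc p(3)] p M by (simp add: mult.assoc)
  qed
  show ?thesis
  proof (rule tendstoI)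
    fix \<epsilon> :: real assume "\<epsilon> > 0"
    have "(\<lambda>j. p ^ j * M) \<longlonglongrightarrow> 0 * M" using p by (intro tendsto_mult LIMSEQ_realpow_zero) auto
    hence "eventually (\<lambda>j. p ^ j * M < \<epsilon>) sequentially" using \<open>\<epsilon> > 0\<close> by (auto dest: order_tendstoD)
    then obtain j where "p ^ j * M < \<epsilon>" by (auto simp: eventually_at_top_linorder)
    thus "eventually (\<lambda>n. dist (e n) 0 < \<epsilon>) sequentially" using iterate[of j] by (auto elim: eventually_mono)
  qed
qed

section \<open>The quadratic recurrence\<close>

context regular_weight
begin

lemma ratio_bounds:
  assumes "0 \<le> a n" "a n \<le> w n"
  shows "0 \<le> a n / w n" "a n / w n \<le> 1"
  using assms weight_nonneg[of n] by (auto simp: divide_le_eq_1)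

text \<open>In the application \<open>w\<close>, \<open>a\<close> and their difference are the
  scaled counts of all, true and false trees, and \<open>convolve a a\<close> counts case 1.\<close>

lemma solution_ratio_tendsto:
  assumes w_rec: "\<And>n. w n = (if n = 1 then 1/4 else 0) + convolve w w n"
    and a_rec: "\<And>n. a n = (if n = 1 then 1/8 else 0) + convolve a a n + convolve (\<lambda>n. w n - a n) w n"
    and a_nonneg: "\<And>n. 0 \<le> a n" and a_le: "\<And>n. a n \<le> w n"
  shows "(\<lambda>n. convolve a a n / w n) \<longlonglongrightarrow> 1/2"
proof -
  have norm_w: "(\<lambda>n. \<bar>w n\<bar>) = w" and norm_a: "(\<lambda>n. \<bar>a n\<bar>) = a"
    using weight_nonneg a_nonneg by auto
  have "\<bar>a n - w n\<bar> = w n - a n" for n using a_le[of n] by simp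
  hence norm_diff: "(\<lambda>n. \<bar>a n - w n\<bar>) = (\<lambda>n. w n - a n)" ..
  have sw: "summable w" by (rule summable_weight)
  have sa: "summable a"
    by (rule summable_comparison_test'[OF sw, where N = 0]) (use a_nonneg a_le in auto)
  define \<theta> where "\<theta> = suminf a"
  have convolve_sums: "convolve p q sums (suminf p * suminf q)"
    if "summable (\<lambda>n. \<bar>p n\<bar>)" "summable (\<lambda>n. \<bar>q n\<bar>)" for p q
    using Cauchy_product_sums[of p q] that by (simp add: convolve_def[abs_def])
  have sums_single: "(\<lambda>n. if n = 1 then x else 0) sums x" for x :: real
    using sums_If_finite[of "\<lambda>n. n = (1::nat)" "\<lambda>_. x"] by simp
  have w_eq: "(\<lambda>n. (if n = 1 then 1/4 else 0) + convolve w w n) = w"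
    by (rule ext) (rule w_rec[symmetric])
  \<comment> \<open>Summing the recurrence over all \<open>n\<close> evaluates the equation of the
    generating function at 1; its only root is the double root 1/2.\<close>
  have "w sums (1/4 + suminf w * suminf w)"
    using sums_add[OF sums_single[of "1/4"] convolve_sums[of w w]] sw
    unfolding w_eq norm_w by blast
  hence "suminf w = 1/4 + suminf w * suminf w" by (simp add: sums_iff)
  hence "(suminf w - 1/2)\<^sup>2 = 0" by (simp add: power2_eq_square algebra_simps)
  hence W: "suminf w = 1/2" by simp
  have diff: "summable (\<lambda>n. \<bar>w n - a n\<bar>)" "(\<Sum>n. w n - a n) = 1/2 - \<theta>"
    using summable_diff[OF sw sa] suminf_diff[OF sw sa] norm_diff
    by (auto simp: W \<theta>_def abs_minus_commute)
  have a_eq: "(\<lambda>n. (if n = 1 then 1/8 else 0) + convolve a a n + convolve (\<lambda>n. w n - a n) w n) = a"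
    by (rule ext) (rule a_rec[symmetric])
  have "a sums (1/8 + \<theta> * \<theta> + (1/2 - \<theta>) * (1/2))"
    using sums_add[OF sums_add[OF sums_single[of "1/8"] convolve_sums[of a a]]
        convolve_sums[of "\<lambda>n. w n - a n" w]] sw sa diff
    unfolding a_eq norm_w norm_a W diff(2) \<theta>_def[symmetric] by blast
  hence theta_eq: "\<theta> = 1/8 + \<theta> * \<theta> + (1/2 - \<theta>) * (1/2)" by (simp add: sums_iff \<theta>_def)
  \<comment> \<open>The upper bound keeps the denominator \<open>3/2 - 2 * \<theta>\<close>
    positive.\<close>
  have theta_le: "\<theta> \<le> 1/2" and theta_ge: "0 \<le> \<theta>"
    unfolding \<theta>_def W[symmetric] using sa sw a_le a_nonneg by (auto intro: suminf_le suminf_nonneg)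
  \<comment> \<open>If \<open>a n / w n\<close> has a limit \<open>c\<close>, then comparing both sides of the recurrence for \<open>a\<close>
    forces \<open>c = 1 + c * \<theta> - \<theta> + c * (\<theta> - 1/2)\<close>.\<close>
  define c where "c = (1 - \<theta>) / (3/2 - 2 * \<theta>)"
  have c_eq: "1 - \<theta> = c * (3/2 - 2 * \<theta>)" using theta_le by (simp add: c_def)
  define d where "d n = a n - c * w n" for n
  have "(\<lambda>n. d n / w n) \<longlonglongrightarrow> 0"
  proof (rule tendsto_zero_if_contracting)
    have "\<bar>d n / w n\<bar> \<le> 1 + \<bar>c\<bar>" for n
    proof (cases "n = 0")
      case False
      hence "d n / w n = a n / w n - c" using weight_pos[of n] by (simp add: d_def diff_divide_distrib)
      thus ?thesis using ratio_bounds[of a n, OF a_nonneg a_le] by linarith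
    qed (simp add: weight_0)
    thus "Bseq (\<lambda>n. d n / w n)" by (intro BseqI'[where K = "1 + \<bar>c\<bar>"]) simp
  next
    fix E :: real assume E: "E > 0" and "eventually (\<lambda>n. \<bar>d n / w n\<bar> \<le> E) sequentially"
    from this(2) have d_le: "eventually (\<lambda>n. \<bar>d n\<bar> \<le> E * w n) sequentially"
      using eventually_gt_at_top[of 0]
    proof eventually_elim
      case (elim n)
      thus ?case using weight_pos[of n] by (simp add: pos_divide_le_eq)
    qed
    let ?p = "\<lambda>n. n div 2 + 1" and ?q = "\<lambda>n. n - n div 2"
    let ?H = "\<lambda>m a b n. \<Sum>k<m n. a k * b (n - k) :: real"
    let ?z = "\<lambda>n. a n - w n"
    have p: "k < ?p n \<Longrightarrow> 2 * k \<le> n" and q: "k < ?q n \<Longrightarrow> 2 * k \<le> n" for n k :: nat by auto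
    have ww: "(\<lambda>n. w n / w n) \<longlonglongrightarrow> 1"
      using weight_shift[of 0] by simp
    \<comment> \<open>In the far factors, \<open>a\<close> is replaced by \<open>c * w + d\<close>
      and \<open>a - w\<close> by \<open>(c - 1) * w + d\<close>. What remains of
      \<open>d n / w n\<close> without the two sums having far factor \<open>d\<close> is
      \<open>r n\<close>; the choice of \<open>c\<close> makes its limit 0.\<close>
    define r where "r n = (1 - c) * (w n / w n) + (c - 1) * (?H ?p a w n / w n) + c * (?H ?q ?z w n / w n)" for n
    have z_sum: "(\<Sum>n. ?z n) = \<theta> - 1/2" using suminf_diff[OF sa sw] by (simp add: \<theta>_def W)
    have "r \<longlonglongrightarrow> (1 - c) * 1 + (c - 1) * (suminf a * 1) + c * ((\<Sum>n. ?z n) * 1)"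
      unfolding r_def
      by (intro tendsto_intros head_sum_tendsto ww filterlim_halves p q)
         (use sa diff in \<open>simp_all add: norm_a abs_minus_commute\<close>)
    also have "(1 - c) * 1 + (c - 1) * (suminf a * 1) + c * ((\<Sum>n. ?z n) * 1) = 0"
      unfolding z_sum using c_eq by (simp add: algebra_simps flip: \<theta>_def)
    finally have "(\<lambda>n. \<bar>r n\<bar>) \<longlonglongrightarrow> 0" by (rule tendsto_rabs_zero)
    hence r0: "eventually (\<lambda>n. \<bar>r n\<bar> < E/12) sequentially"
      by (rule order_tendstoD(2)) (use E in simp)
    have h1: "eventually (\<lambda>n. \<bar>?H ?p a d n\<bar> \<le> (\<theta> * E + E/12) * w n) sequentially"
      using E sa by (intro head_sum_bound[OF _ d_le] filterlim_halves p) (auto simp: norm_a \<theta>_def)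
    have h2: "eventually (\<lambda>n. \<bar>?H ?q ?z d n\<bar> \<le> ((1/2 - \<theta>) * E + E/12) * w n) sequentially"
      using E diff by (intro head_sum_bound[OF _ d_le] filterlim_halves q) (auto simp: norm_diff abs_minus_commute)
    \<comment> \<open>The two heads have total mass
      \<open>\<theta> + (1/2 - \<theta>) = 1/2\<close>, and three errors of \<open>E/12\<close> add
      a quarter of \<open>E\<close>.\<close>
    show "eventually (\<lambda>n. \<bar>d n / w n\<bar> \<le> 3/4 * E) sequentially"
      using r0 h1 h2 eventually_gt_at_top[of 1]
    proof eventually_elim
      case (elim n)
      have wn: "w n > 0" using elim by (intro weight_pos) auto
      have "convolve (\<lambda>n. w n - a n) w n = convolve w w n - convolve a w n"
        by (simp add: convolve_def algebra_simps sum_subtractf)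
      moreover have "convolve a ?z n = convolve a a n - convolve a w n"
        by (simp add: convolve_def algebra_simps sum_subtractf)
      \<comment> \<open>For \<open>n > 1\<close> the leaf terms vanish and
        \<open>convolve w w n\<close> is \<open>w n\<close>, so the two convolutions in
        \<open>a_rec\<close> merge into one with the factor \<open>a - w\<close>.\<close>
      ultimately have "a n = w n + convolve a ?z n"
        using a_rec[of n] w_rec[of n] elim by simp
      also have "convolve a ?z n = ?H ?p a ?z n + ?H ?q ?z a n"
        by (rule convolve_halves)
      also have "?H ?p a ?z n = (c - 1) * ?H ?p a w n + ?H ?p a d n"
        by (simp add: d_def algebra_simps sum_distrib_left sum.distrib sum_subtractf del: sum.lessThan_Suc)
      also have "?H ?q ?z a n = c * ?H ?q ?z w n + ?H ?q ?z d n"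
        by (simp add: d_def algebra_simps sum_distrib_left sum.distrib sum_subtractf del: sum.lessThan_Suc)
      finally have a_split: "a n = w n + ((c - 1) * ?H ?p a w n + ?H ?p a d n + (c * ?H ?q ?z w n + ?H ?q ?z d n))" .
      have rearrange: "x - c * y = (1 - c) * y + (c - 1) * s + c * u + t + v"
        if "x = y + ((c - 1) * s + t + (c * u + v))" for x y s t u v
        using that by (simp add: algebra_simps)
      have "d n / w n = r n + ?H ?p a d n / w n + ?H ?q ?z d n / w n"
        unfolding d_def[of n] rearrange[OF a_split] r_def
        by (simp only: add_divide_distrib times_divide_eq_right)
      moreover have "\<bar>?H ?p a d n / w n\<bar> \<le> \<theta> * E + E/12" "\<bar>?H ?q ?z d n / w n\<bar> \<le> (1/2 - \<theta>) * E + E/12"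
        using elim(2,3) wn by (simp_all add: pos_divide_le_eq del: sum.lessThan_Suc)
      moreover have "(1/2 - \<theta>) * E = E/2 - \<theta> * E" by (simp add: algebra_simps)
      ultimately show ?case using elim(1) by linarith
    qed
  qed auto
  hence "(\<lambda>n. d n / w n + c * (w n / w n)) \<longlonglongrightarrow> 0 + c * 1"
    using weight_shift[of 0] by (intro tendsto_intros) simp_all
  moreover have "d n / w n + c * (w n / w n) = a n / w n" for n
    by (simp add: d_def diff_divide_distrib)
  ultimately have "(\<lambda>n. a n / w n) \<longlonglongrightarrow> c" by simp
  hence "(\<lambda>n. convolve a a n / w n) \<longlonglongrightarrow> \<theta> * c + \<theta> * c"
    using convolve_tendsto[of a a c c] sa by (simp add: norm_a flip: \<theta>_def)
  also have "\<theta> * c + \<theta> * c = 2 * \<theta> * (1 - \<theta>) / (3/2 - 2 * \<theta>)"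
    by (simp add: c_def)
  \<comment> \<open>By \<open>theta_eq\<close>,
    \<open>\<theta> * \<theta> = 3/2 * \<theta> - 3/8\<close>, so the numerator is half the
    denominator at either root of the quadratic.\<close>
  also have "2 * \<theta> * (1 - \<theta>) = 1/2 * (3/2 - 2 * \<theta>)"
    using theta_eq by (simp add: algebra_simps)
  also have "1/2 * (3/2 - 2 * \<theta>) / (3/2 - 2 * \<theta>) = 1/2"
    using theta_le by simp
  finally show ?thesis .
qed

end

section \<open>The coefficients of the square root\<close>

text \<open>The coefficient of x^n in (1 - sqrt (1 - x)) / 2; at \<open>n = 0\<close> the two
  constants cancel.\<close>

definition sqrt_weight :: "nat \<Rightarrow> real" where
  "sqrt_weight n = (if n = 0 then 0 else - (1/2) * ((1/2) gchoose n) * (-1) ^ n)"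

text \<open>With \<open>h\<close> the coefficients of sqrt (1 - x) and \<open>\<delta>\<close> those
  of 1, this expands the square of (1 - sqrt (1 - x)) / 2. Vandermonde's identity shows that
  \<open>h\<close> convolved with itself gives 1 - x.\<close>

lemma sqrt_weight_convolve:
  "sqrt_weight n = (if n = 1 then 1/4 else 0) + convolve sqrt_weight sqrt_weight n"
proof (cases "n = 0")
  case False
  define h :: "nat \<Rightarrow> real" where "h k = ((1/2) gchoose k) * (-1) ^ k" for k
  define \<delta> :: "nat \<Rightarrow> real" where "\<delta> k = (if k = 0 then 1 else 0)" for k
  have w: "sqrt_weight k = (\<delta> k - h k) / 2" for k
    by (auto simp: sqrt_weight_def h_def \<delta>_def)
  have "(\<Sum>i\<le>n. h i * h (n - i)) = (-1) ^ n * (\<Sum>i=0..n. ((1/2) gchoose i) * ((1/2) gchoose (n - i)))"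
    unfolding sum_distrib_left
    by (intro sum.cong) (auto simp: h_def simp flip: power_add)
  also have "\<dots> = (-1) ^ n * (1 gchoose n)" by (simp add: gbinomial_Vandermonde)
  also have "\<dots> = (if n = 1 then -1 else 0)"
    using False by (simp add: binomial_gbinomial[of 1, simplified, symmetric])
  finally have hh: "(\<Sum>i\<le>n. h i * h (n - i)) = (if n = 1 then -1 else 0)" .
  have "(\<Sum>i\<le>n. \<delta> i * f i) = f 0" "(\<Sum>i\<le>n. f i * \<delta> (n - i)) = f n" for f
    by (subst sum.mono_neutral_right[of _ "{0}"] sum.mono_neutral_right[of _ "{n}"], auto simp: \<delta>_def)+
  note delta = this
  have "convolve sqrt_weight sqrt_weight n = (\<Sum>i\<le>n. (\<delta> i * \<delta> (n - i) - \<delta> i * h (n - i) - h i * \<delta> (n - i) + h i * h (n - i)) / 4)"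
    unfolding convolve_def w by (intro sum.cong) (auto simp: field_simps)
  also have "\<dots> = (\<delta> n - h n - h n + (if n = 1 then -1 else 0)) / 4"
    by (simp add: sum.distrib sum_subtractf delta hh flip: sum_divide_distrib)
  finally show ?thesis using False by (auto simp: w \<delta>_def)
qed (simp add: sqrt_weight_def convolve_def)

text \<open>Consecutive values satisfy (n + 1) w(n + 1) = (n - 1/2) w(n), and the factor on the
  right is positive for n at least 1.\<close>

lemma sqrt_weight_pos: "n > 0 \<Longrightarrow> sqrt_weight n > 0"
proof (induction n rule: nat_induct_non_zero)
  case 1
  show ?case by (simp add: sqrt_weight_def)
next
  case (Suc n)
  have "real (Suc n) * ((1/2) gchoose Suc n) = (1/2 - real n) * ((1/2) gchoose n)"
    using gbinomial_mult_1[of "1/2 :: real" n] by (simp add: algebra_simps)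
  moreover have "real (Suc n) * sqrt_weight (Suc n) =
      1/2 * (-1) ^ n * (real (Suc n) * ((1/2) gchoose Suc n))"
    by (simp add: sqrt_weight_def)
  ultimately have "real (Suc n) * sqrt_weight (Suc n) =
      1/2 * (-1) ^ n * ((1/2 - real n) * ((1/2) gchoose n))"
    by (simp only:)
  also have "\<dots> = (real n - 1/2) * sqrt_weight n"
    using Suc.hyps by (simp add: sqrt_weight_def field_simps)
  also have "\<dots> > 0" using Suc by simp
  finally show ?case by (rule zero_less_mult_pos) simp
qed

text \<open>\<open>gbinomial_asymptotic\<close> gives the limit -1/2 divided by Gamma (-1/2). As
  -1/2 is not a pole, the functional equation yields Gamma (-1/2) = -2 sqrt pi.\<close>

lemma sqrt_weight_tendsto: "(\<lambda>n. sqrt_weight n * real n powr (3/2)) \<longlonglongrightarrow> 1 / (4 * sqrt pi)"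
proof -
  have "- (1/2) \<notin> (\<int>\<^sub>\<le>\<^sub>0 :: real set)"
  proof
    assume "- (1/2) \<in> (\<int>\<^sub>\<le>\<^sub>0 :: real set)"
    then obtain n where "- (1/2) = - real n" by (rule nonpos_Ints_cases')
    hence "real (2 * n) = real 1" by simp
    hence "2 * n = 1" by (simp only: of_nat_eq_iff)
    thus False by presburger
  qed
  hence "Gamma (1/2 :: real) = (-1/2) * Gamma (- (1/2))"
    using Gamma_plus1[of "-1/2 :: real"] by simp
  hence G: "Gamma (- (1/2) :: real) = - 2 * sqrt pi" by (simp add: Gamma_one_half_real)
  have "(\<lambda>n. (- 1/2) * (((1/2) gchoose n) / ((-1) ^ n / exp ((1/2 + 1) * of_real (ln (real n))))))
     \<longlonglongrightarrow> (- 1/2) * inverse (Gamma (- (1/2 :: real)))"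
    by (intro tendsto_mult tendsto_const gbinomial_asymptotic)
  moreover have "eventually (\<lambda>n. (- 1/2) * (((1/2) gchoose n) / ((-1) ^ n / exp ((1/2 + 1) * of_real (ln (real n)))))
      = sqrt_weight n * real n powr (3/2)) sequentially"
    using eventually_gt_at_top[of 0]
    by eventually_elim
       (simp add: sqrt_weight_def powr_def field_simps power_mult_distrib[symmetric] flip: power_add)
  ultimately have "(\<lambda>n. sqrt_weight n * real n powr (3/2)) \<longlonglongrightarrow> (- 1/2) * inverse (Gamma (- (1/2 :: real)))"
    by (rule Lim_transform_eventually)
  thus ?thesis by (simp add: G inverse_eq_divide)
qed

interpretation sqrt_weight: regular_weight sqrt_weight "3/2" "1 / (4 * sqrt pi)"
proof unfold_locales
  show "sqrt_weight 0 = 0" by (simp add: sqrt_weight_def)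
qed (auto intro: sqrt_weight_pos sqrt_weight_tendsto)

section \<open>Rows as trees with truth values at the leaves\<close>

text \<open>Variable names can be forgotten because they are distinct and in fixed order. Subtrees
  then belong to the same class, which gives convolution recurrences.\<close>

datatype truth_tree = Leaf bool | Node truth_tree truth_tree

primrec leaves :: "truth_tree \<Rightarrow> bool list" where
  "leaves (Leaf b) = [b]"
| "leaves (Node l r) = leaves l @ leaves r"

primrec tree_value :: "truth_tree \<Rightarrow> bool" where
  "tree_value (Leaf b) = b"
| "tree_value (Node l r) = (tree_value l \<longrightarrow> tree_value r)"

primrec substitute :: "(nat \<Rightarrow> bool) \<Rightarrow> formula \<Rightarrow> truth_tree" where
  "substitute v (Var i) = Leaf (v i)"
| "substitute v (Imp \<psi> \<phi>) = Node (substitute v \<psi>) (substitute v \<phi>)"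

text \<open>Recovers the formula from its tree; meaningful when \<open>xs\<close> has one entry per
  leaf.\<close>

primrec relabel :: "nat list \<Rightarrow> truth_tree \<Rightarrow> formula" where
  "relabel xs (Leaf b) = Var (hd xs)"
| "relabel xs (Node l r) =
     Imp (relabel (take (length (leaves l)) xs) l) (relabel (drop (length (leaves l)) xs) r)"

lemma leaves_substitute: "leaves (substitute v A) = map v (variable_sequence A)"
  by (induction A) auto

lemma tree_value_substitute: "tree_value (substitute v A) = truth_value v A"
  by (induction A) auto

lemma variable_sequence_relabel:
  "length xs = length (leaves t) \<Longrightarrow> variable_sequence (relabel xs t) = xs"
  by (induction t arbitrary: xs) (auto simp: length_Suc_conv)

lemma relabel_substitute: "relabel (variable_sequence A) (substitute v A) = A"
  by (induction A) (auto simp: leaves_substitute)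

lemma substitute_relabel:
  "map v xs = leaves t \<Longrightarrow> substitute v (relabel xs t) = t"
proof (induction t arbitrary: xs)
  case (Node l r)
  have "length (leaves l) \<le> length xs" using arg_cong[OF Node.prems, of length] by simp
  moreover have "map v (take (length (leaves l)) xs) = leaves l" "map v (drop (length (leaves l)) xs) = leaves r"
    using Node.prems by (simp_all flip: take_map drop_map)
  ultimately show ?case using Node.IH by simp
qed auto

lemma leaves_nonempty: "leaves t \<noteq> []"
  by (induction t) auto

definition count_trees :: "(truth_tree \<Rightarrow> bool) \<Rightarrow> nat \<Rightarrow> nat" where
  "count_trees P n = card {t. length (leaves t) = n \<and> P t}"

text \<open>The inverse relabels the leaves by 1 to n and reads the valuation off them; list
  positions start at 0, hence \<open>i - 1\<close>.\<close>

lemma substitute_bij_betw: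
  "bij_betw (\<lambda>(A, v). substitute v A) (Defs.rows n) {t. length (leaves t) = n}"
proof (rule bij_betw_byWitness[where f' =
      "\<lambda>t. (relabel [1..<Suc n] t, \<lambda>i\<in>{1..n}. leaves t ! (i - 1))"])
  show "\<forall>r\<in>Defs.rows n. (\<lambda>t. (relabel [1..<Suc n] t, \<lambda>i\<in>{1..n}. leaves t ! (i - 1)))
      ((\<lambda>(A, v). substitute v A) r) = r"
  proof (clarsimp simp: Defs.rows_def bracketed_implications_def simp del: upt_Suc, intro conjI)
    fix A v assume A: "variable_sequence A = [Suc 0..<Suc n]" and v: "v \<in> valuations n"
    show "relabel [Suc 0..<Suc n] (substitute v A) = A"
      using relabel_substitute[of A v] A by simp
    \<comment> \<open>Off \<open>{1..n}\<close> both functions are \<open>undefined\<close>, since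
      \<open>valuations\<close> are extensional.\<close>
    show "(\<lambda>i\<in>{Suc 0..n}. leaves (substitute v A) ! (i - Suc 0)) = v"
      using v by (auto simp: valuations_def leaves_substitute A PiE_iff extensional_def fun_eq_iff simp del: upt_Suc)
  qed
  have map: "map (\<lambda>i\<in>{1..n}. leaves t ! (i - 1)) [1..<Suc n] = leaves t" if "length (leaves t) = n" for t
    using that by (intro nth_equalityI) (auto simp del: upt_Suc)
  show "\<forall>t\<in>{t. length (leaves t) = n}. (\<lambda>(A, v). substitute v A)
      (relabel [1..<Suc n] t, \<lambda>i\<in>{1..n}. leaves t ! (i - 1)) = t"
    using substitute_relabel[OF map] by auto
  show "(\<lambda>(A, v). substitute v A) ` Defs.rows n \<subseteq> {t. length (leaves t) = n}"
    by (auto simp: Defs.rows_def bracketed_implications_def leaves_substitute simp del: upt_Suc)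
  show "(\<lambda>t. (relabel [1..<Suc n] t, \<lambda>i\<in>{1..n}. leaves t ! (i - 1))) ` {t. length (leaves t) = n} \<subseteq> Defs.rows n"
    by (auto simp: Defs.rows_def bracketed_implications_def valuations_def variable_sequence_relabel simp del: upt_Suc)
qed

text \<open>Substitution preserves the top implication and the values of its two sides, so the
  bijection restricts to case 1.\<close>

lemma t_case1_eq_count_trees:
  "t_case1 n = count_trees (\<lambda>t. \<exists>l r. t = Node l r \<and> tree_value l \<and> tree_value r) n"
proof -
  let ?f = "\<lambda>(A, v). substitute v A"
  let ?T = "{t. length (leaves t) = n \<and> (\<exists>l r. t = Node l r \<and> tree_value l \<and> tree_value r)}"
  have case1: "(\<exists>\<psi> \<phi>. A = Imp \<psi> \<phi> \<and> truth_value v \<psi> \<and> truth_value v \<phi>) \<longleftrightarrow>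
      (\<exists>l r. substitute v A = Node l r \<and> tree_value l \<and> tree_value r)" for A v
    by (cases A) (auto simp: tree_value_substitute)
  have "?f ` case1_rows n = {t \<in> ?f ` Defs.rows n. \<exists>l r. t = Node l r \<and> tree_value l \<and> tree_value r}"
    unfolding case1_rows_def case1 by auto
  also have "\<dots> = ?T"
    using substitute_bij_betw[of n] by (auto simp: bij_betw_def)
  finally have "?f ` case1_rows n = ?T" .
  moreover have "inj_on ?f (case1_rows n)"
    using substitute_bij_betw[of n] by (auto simp: bij_betw_def case1_rows_def intro: inj_on_subset)
  ultimately show ?thesis
    unfolding t_case1_def count_trees_def by (metis card_image)
qed

section \<open>Recurrences for the numbers of trees\<close>

lemma trees_Node_eq:
  "{t. length (leaves t) = n \<and> (\<exists>l r. t = Node l r \<and> P l \<and> Q r)} =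
     (\<Union>i\<in>{..n}. (\<lambda>(l, r). Node l r) `
        ({l. length (leaves l) = i \<and> P l} \<times> {r. length (leaves r) = n - i \<and> Q r}))"
  by (auto simp: image_iff)

text \<open>Both subtrees of a node have strictly fewer leaves, because no leaf list is
  empty.\<close>

lemma finite_trees: "finite {t. length (leaves t) = n}"
proof (induction n rule: less_induct)
  case (less n)
  have "{t. length (leaves t) = n} \<subseteq> range Leaf \<union>
     (\<Union>i\<in>{..<n}. \<Union>j\<in>{..<n}. (\<lambda>(l, r). Node l r) `
        ({l. length (leaves l) = i} \<times> {r. length (leaves r) = j}))" (is "_ \<subseteq> ?X")
  proof
    fix t assume t: "t \<in> {t. length (leaves t) = n}"
    show "t \<in> ?X"
    proof (cases t)
      case (Node l r)
      hence "length (leaves l) < n" "length (leaves r) < n"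
        using t leaves_nonempty[of l] leaves_nonempty[of r] by auto
      thus ?thesis using Node by (auto simp: image_iff)
    qed auto
  qed
  moreover have "finite ?X" using less by (auto simp: finite_UN)
  ultimately show ?case by (rule finite_subset)
qed

lemma finite_trees_pred: "finite {t. length (leaves t) = n \<and> P t}"
  by (rule finite_subset[OF _ finite_trees[of n]]) auto

text \<open>The pieces for different \<open>i\<close> are disjoint because \<open>i\<close> is the
  number of leaves of the left subtree.\<close>

lemma count_trees_Node:
  "count_trees (\<lambda>t. \<exists>l r. t = Node l r \<and> P l \<and> Q r) n =
     (\<Sum>i\<le>n. count_trees P i * count_trees Q (n - i))"
  unfolding count_trees_def trees_Node_eq
proof (subst card_UN_disjoint)
  show "(\<Sum>i\<le>n. card ((\<lambda>(l, r). Node l r) `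
          ({l. length (leaves l) = i \<and> P l} \<times> {r. length (leaves r) = n - i \<and> Q r}))) =
      (\<Sum>i\<le>n. card {t. length (leaves t) = i \<and> P t} * card {t. length (leaves t) = n - i \<and> Q t})"
    by (intro sum.cong refl, subst card_image) (auto simp: inj_on_def card_cartesian_product)
qed (auto intro: finite_trees_pred)

lemma count_trees_disj:
  assumes "\<And>t. \<not> (P t \<and> Q t)"
  shows "count_trees (\<lambda>t. P t \<or> Q t) n = count_trees P n + count_trees Q n"
proof -
  have "{t. length (leaves t) = n \<and> (P t \<or> Q t)} =
      {t. length (leaves t) = n \<and> P t} \<union> {t. length (leaves t) = n \<and> Q t}" by auto
  thus ?thesis unfolding count_trees_def using assms
    by (simp, intro card_Un_disjoint finite_trees_pred) auto
qed

lemma count_trees_Leaf: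
  "count_trees (\<lambda>t. \<exists>b. t = Leaf b \<and> P b) n = (if n = 1 then card {b. P b} else 0)"
proof -
  have "{t. length (leaves t) = n \<and> (\<exists>b. t = Leaf b \<and> P b)} = (if n = 1 then Leaf ` {b. P b} else {})"
    by auto
  thus ?thesis by (simp add: count_trees_def card_image inj_on_def)
qed

lemma count_all_trees:
  "count_trees (\<lambda>_. True) n = (if n = 1 then 2 else 0) +
     (\<Sum>i\<le>n. count_trees (\<lambda>_. True) i * count_trees (\<lambda>_. True) (n - i))"
proof -
  \<comment> \<open>The conjuncts \<open>True\<close> give the tautology the shape of
    \<open>count_trees_Leaf\<close> and \<open>count_trees_Node\<close>.\<close>
  have "(\<lambda>_. True) = (\<lambda>t. (\<exists>b. t = Leaf b \<and> True) \<or> (\<exists>l r. t = Node l r \<and> True \<and> True))"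
    by (rule ext) (metis truth_tree.exhaust)
  hence "count_trees (\<lambda>_. True) n =
      count_trees (\<lambda>t. (\<exists>b. t = Leaf b \<and> True) \<or> (\<exists>l r. t = Node l r \<and> True \<and> True)) n"
    by simp
  also have "\<dots> = (if n = 1 then card {b::bool. True} else 0) +
      (\<Sum>i\<le>n. count_trees (\<lambda>_. True) i * count_trees (\<lambda>_. True) (n - i))"
    by (subst count_trees_disj, force, subst count_trees_Leaf, subst count_trees_Node, rule refl)
  finally show ?thesis by simp
qed

text \<open>A true implication has either two true sides or a false left side with an arbitrary
  right side; these alternatives exclude each other.\<close>

lemma count_true_trees:
  "count_trees tree_value n = (if n = 1 then 1 else 0) +
     (\<Sum>i\<le>n. count_trees tree_value i * count_trees tree_value (n - i)) +
     (\<Sum>i\<le>n. count_trees (\<lambda>t. \<not> tree_value t) i * count_trees (\<lambda>_. True) (n - i))"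
proof -
  have "tree_value t \<longleftrightarrow> (((\<exists>b. t = Leaf b \<and> b) \<or> (\<exists>l r. t = Node l r \<and> tree_value l \<and> tree_value r)) \<or>
      (\<exists>l r. t = Node l r \<and> \<not> tree_value l \<and> True))" for t
    by (cases t) auto
  hence "tree_value = (\<lambda>t. ((\<exists>b. t = Leaf b \<and> b) \<or> (\<exists>l r. t = Node l r \<and> tree_value l \<and> tree_value r)) \<or>
      (\<exists>l r. t = Node l r \<and> \<not> tree_value l \<and> True))" ..
  hence "count_trees tree_value n = count_trees (\<lambda>t. ((\<exists>b. t = Leaf b \<and> b) \<or>
      (\<exists>l r. t = Node l r \<and> tree_value l \<and> tree_value r)) \<or>
      (\<exists>l r. t = Node l r \<and> \<not> tree_value l \<and> True)) n"
    by (rule arg_cong)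
  also have "\<dots> = (if n = 1 then card {b. b} else 0) +
     (\<Sum>i\<le>n. count_trees tree_value i * count_trees tree_value (n - i)) +
     (\<Sum>i\<le>n. count_trees (\<lambda>t. \<not> tree_value t) i * count_trees (\<lambda>_. True) (n - i))"
    by (subst count_trees_disj, force, subst count_trees_disj, force,
        subst count_trees_Leaf, subst count_trees_Node, subst count_trees_Node, rule refl)
  also have "{b. b} = {True}" by auto
  finally show ?thesis by simp
qed

lemma count_trees_compl:
  "count_trees P n + count_trees (\<lambda>t. \<not> P t) n = count_trees (\<lambda>_. True) n"
  using count_trees_disj[of P "\<lambda>t. \<not> P t" n] by simp

section \<open>Asymptotics of the case 1 rows\<close>

text \<open>The zero constant term kills the summands at \<open>i = 0\<close> and
  \<open>i = n\<close>, so the convolution at \<open>n\<close> depends on smaller indices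
  alone.\<close>

lemma convolution_square_unique:
  assumes f: "f 0 = 0" "\<And>n. f n = p n + convolve f f n"
    and g: "g 0 = 0" "\<And>n. g n = p n + convolve g g n"
  shows "f = g"
proof
  fix n show "f n = g n"
  proof (induction n rule: less_induct)
    case (less n)
    have "f i * f (n - i) = g i * g (n - i)" if "i \<le> n" for i
      using that less[of i] less[of "n - i"] f(1) g(1) by (cases "i = 0"; cases "i = n") auto
    hence "convolve f f n = convolve g g n" unfolding convolve_def by (intro sum.cong) auto
    thus ?case using f(2)[of n] g(2)[of n] by simp
  qed
qed

lemma convolve_scaled:
  "convolve (\<lambda>n. real (f n) / x ^ n) (\<lambda>n. real (g n) / x ^ n) n = real (\<Sum>i\<le>n. f i * g (n - i)) / x ^ n"
  unfolding convolve_def of_nat_sum sum_divide_distrib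
  by (intro sum.cong) (auto simp flip: power_add)

text \<open>Division by \<open>8 ^ n\<close> turns the leaf term 2 into 1/4, so both sides satisfy
  the same recurrence.\<close>

lemma count_all_trees_scaled:
  "real (count_trees (\<lambda>_. True) n) / 8 ^ n = sqrt_weight n"
proof (rule fun_cong[where x = n], rule convolution_square_unique[where p = "\<lambda>n. if n = 1 then 1/4 else 0"])
  show "real (count_trees (\<lambda>_. True) 0) / 8 ^ 0 = 0"
    by (simp add: count_trees_def leaves_nonempty)
  show "real (count_trees (\<lambda>_. True) n) / 8 ^ n = (if n = 1 then 1/4 else 0) +
      convolve (\<lambda>n. real (count_trees (\<lambda>_. True) n) / 8 ^ n) (\<lambda>n. real (count_trees (\<lambda>_. True) n) / 8 ^ n) n" for n
    unfolding convolve_scaled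
    by (subst count_all_trees) (simp add: add_divide_distrib)
  show "sqrt_weight 0 = 0" by (rule sqrt_weight.weight_0)
  show "sqrt_weight n = (if n = 1 then 1/4 else 0) + convolve sqrt_weight sqrt_weight n" for n
    by (rule sqrt_weight_convolve)
qed

text \<open>Case 1 trees are nodes over two true trees, so their scaled count is
  \<open>convolve a a\<close>.\<close>

lemma t_case1_ratio: "(\<lambda>n. real (t_case1 n) / 8 ^ n / sqrt_weight n) \<longlonglongrightarrow> 1/2"
proof -
  define a where "a n = real (count_trees tree_value n) / 8 ^ n" for n
  have false: "sqrt_weight n - a n = real (count_trees (\<lambda>t. \<not> tree_value t) n) / 8 ^ n" for n
    using count_trees_compl[of tree_value n]
    by (simp add: a_def flip: count_all_trees_scaled diff_divide_distrib)
  have "(\<lambda>n. convolve a a n / sqrt_weight n) \<longlonglongrightarrow> 1/2"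
  proof (rule sqrt_weight.solution_ratio_tendsto)
    show "sqrt_weight n = (if n = 1 then 1/4 else 0) + convolve sqrt_weight sqrt_weight n" for n
      by (rule sqrt_weight_convolve)
    show "a n = (if n = 1 then 1/8 else 0) + convolve a a n + convolve (\<lambda>n. sqrt_weight n - a n) sqrt_weight n" for n
      unfolding false unfolding count_all_trees_scaled[symmetric, abs_def] a_def convolve_scaled
      by (subst count_true_trees) (simp add: add_divide_distrib)
    show "0 \<le> a n" for n by (simp add: a_def)
    have "0 \<le> sqrt_weight n - a n" for n unfolding false by simp
    thus "a n \<le> sqrt_weight n" for n by simp
  qed
  moreover have "convolve a a n = real (t_case1 n) / 8 ^ n" for n
    unfolding a_def convolve_scaled t_case1_eq_count_trees count_trees_Node ..
  ultimately show ?thesis by simp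
qed

theorem theorem5p5:
  "(\<lambda>n. real (t_case1 n)) \<sim>[at_top]
     (\<lambda>n. (1 / 2) * (2 ^ (3 * n - 2) / sqrt (pi * real n ^ 3)))"
proof (rule asymp_equivI')
  \<comment> \<open>The factor \<open>8 * sqrt pi\<close> collects the constants of the target: 1/2,
    \<open>sqrt pi\<close>, and the 4 in \<open>8 ^ n = 4 * 2 ^ (3 * n - 2)\<close>.\<close>
  have "(\<lambda>n. (real (t_case1 n) / 8 ^ n / sqrt_weight n) * (sqrt_weight n * real n powr (3/2)) * (8 * sqrt pi))
      \<longlonglongrightarrow> 1/2 * (1 / (4 * sqrt pi)) * (8 * sqrt pi)"
    by (intro tendsto_mult tendsto_const t_case1_ratio sqrt_weight_tendsto)
  also have "1/2 * (1 / (4 * sqrt pi)) * (8 * sqrt pi) = 1" by simp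
  finally have lim: "(\<lambda>n. (real (t_case1 n) / 8 ^ n / sqrt_weight n) * (sqrt_weight n * real n powr (3/2)) * (8 * sqrt pi))
      \<longlonglongrightarrow> 1" .
  have "eventually (\<lambda>n. (real (t_case1 n) / 8 ^ n / sqrt_weight n) * (sqrt_weight n * real n powr (3/2)) * (8 * sqrt pi) =
      real (t_case1 n) / ((1 / 2) * (2 ^ (3 * n - 2) / sqrt (pi * real n ^ 3)))) sequentially"
    using eventually_gt_at_top[of 0]
  proof eventually_elim
    case (elim n)
    have "sqrt (real n ^ 3) = (real n powr 3) powr (1/2)"
      using elim by (simp add: powr_half_sqrt)
    also have "\<dots> = real n powr (3/2)" by (simp only: powr_powr) simp
    finally have "sqrt (real n ^ 3) = real n powr (3/2)" .
    moreover have "(8::real) ^ n = 4 * 2 ^ (3 * n - 2)"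
    proof -
      have "(8::real) ^ n = 2 ^ (3 * n)" by (simp add: power_mult)
      \<comment> \<open>The truncated subtraction is exact because \<open>n > 0\<close>.\<close>
      also have "\<dots> = 2 ^ (2 + (3 * n - 2))" using elim by (intro arg_cong[where f = "(^) 2"]) linarith
      finally show ?thesis by (simp only: power_add) simp
    qed
    ultimately show ?case using sqrt_weight_pos[OF elim]
      by (simp add: real_sqrt_mult)
  qed
  with lim show "(\<lambda>n. real (t_case1 n) / ((1 / 2) * (2 ^ (3 * n - 2) / sqrt (pi * real n ^ 3)))) \<longlonglongrightarrow> 1"
    by (rule Lim_transform_eventually)
qed

end
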